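(* Let $A$ be the adjacency matrix of an undirected network on $n$ nodes with at least one edge, and let $\widetilde{A}=A-\hat{\eta}\hat{\eta}'$, where $\hat{\eta}=V^{-1/2}A{\bf 1}_n$ and $V={\bf 1}_n'A{\bf 1}_n$. Let $$T_n=\sum_{i_1,i_2,i_3\,(dist)}\widetilde{A}_{i_1i_2}\widetilde{A}_{i_2i_3}\widetilde{A}_{i_3i_1},\qquad Q_n=\sum_{i_1,i_2,i_3,i_4\,(dist)}\widetilde{A}_{i_1i_2}\widetilde{A}_{i_2i_3}\widetilde{A}_{i_3i_4}\widetilde{A}_{i_4i_1}.$$ Then $$T_n=\mathrm{tr}(\widetilde{A}^3)-3\,\mathrm{tr}(\widetilde{A}\circ\widetilde{A}^2)+2\,\mathrm{tr}(\widetilde{A}\circ\widetilde{A}\circ\widetilde{A})$$ and $$\begin{aligned}Q_n=\;&\mathrm{tr}(\widetilde{A}^4)-4\,\mathrm{tr}(\widetilde{A}\circ\widetilde{A}^3)+8\,\mathrm{tr}(\widetilde{A}\circ\widetilde{A}\circ\widetilde{A}^2)-6\,\mathrm{tr}(\widetilde{A}\circ\widetilde{A}\circ\widetilde{A}\circ\widetilde{A})\\&-2\,\mathrm{tr}(\widetilde{A}^2\circ\widetilde{A}^2)+2\cdot{\bf 1}_n'[\mathrm{diag}(\widetilde{A})(\widetilde{A}\circ\widetilde{A})\mathrm{diag}(\widetilde{A})]{\bf 1}_n+{\bf 1}_n'[\widetilde{A}\circ\widetilde{A}\circ\widetilde{A}\circ\widetilde{A}]{\bf 1}_n.\end{aligned}$$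 Moreover, the complexity of computing both $T_n$ and $Q_n$ is $O(n^2\bar{d})$, where $\bar{d}$ is the average degree of the network.
   Context: The adjacency matrix $A\in\{0,1\}^{n\times n}$ is symmetric with zero diagonal. ${\bf 1}_n\in\mathbb{R}^n$ is the all-ones vector. $\sum_{i_1,\ldots,i_m(dist)}$ is the sum over all $m$-tuples of pairwise distinct indices in $\{1,\ldots,n\}$. $M\circ N$ is the Hadamard (entrywise) product, $\mathrm{tr}$ is the trace, and for a square matrix $M$, $\mathrm{diag}(M)$ is the diagonal matrix $\mathrm{diag}(M_{11},\ldots,M_{nn})$. Powers such as $\widetilde{A}^2,\widetilde A^3$ are ordinary matrix powers. Complexity means the number of arithmetic operations; the average degree is $\bar d=V/n$. *)

theory Defs
  imports Complex_Main "Jordan_Normal_Form.Matrix"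
begin

section \<open>Matrices\<close>

definition ones_vec :: "nat \<Rightarrow> real vec" where
  "ones_vec n = vec n (\<lambda>_. 1)"

definition trace_mat :: "real mat \<Rightarrow> real" where
  "trace_mat M = (\<Sum>i<dim_row M. M $$ (i, i))"

definition hadamard :: "real mat \<Rightarrow> real mat \<Rightarrow> real mat" (infixl "\<circ>\<^sub>H" 72) where
  "M \<circ>\<^sub>H N = mat (dim_row M) (dim_col M) (\<lambda>(i, j). M $$ (i, j) * N $$ (i, j))"

definition diag_part :: "real mat \<Rightarrow> real mat" where
  "diag_part M = mat_diag (dim_row M) (\<lambda>i. M $$ (i, i))"

definition outer_prod :: "real vec \<Rightarrow> real vec \<Rightarrow> real mat" where
  "outer_prod v w = mat (dim_vec v) (dim_vec w) (\<lambda>(i, j). v $ i * w $ j)"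


section \<open>Networks and the statistics\<close>

definition adjacency_mat :: "nat \<Rightarrow> real mat \<Rightarrow> bool" where
  "adjacency_mat n A \<longleftrightarrow>
     A \<in> carrier_mat n n \<and> A\<^sup>T = A \<and>
     (\<forall>i<n. \<forall>j<n. A $$ (i, j) \<in> {0, 1}) \<and> (\<forall>i<n. A $$ (i, i) = 0)"

definition has_edge :: "real mat \<Rightarrow> bool" where
  "has_edge A \<longleftrightarrow> (\<exists>i<dim_row A. \<exists>j<dim_col A. A $$ (i, j) = 1)"

definition total_degree :: "real mat \<Rightarrow> real" where
  "total_degree A = ones_vec (dim_row A) \<bullet> (A *\<^sub>v ones_vec (dim_col A))"

definition avg_degree :: "real mat \<Rightarrow> real" where
  "avg_degree A = total_degree A / real (dim_row A)"

definition eta_hat :: "real mat \<Rightarrow> real vec" where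
  "eta_hat A = (total_degree A powr (- 1 / 2)) \<cdot>\<^sub>v (A *\<^sub>v ones_vec (dim_col A))"

definition A_tilde :: "real mat \<Rightarrow> real mat" where
  "A_tilde A = A - outer_prod (eta_hat A) (eta_hat A)"

definition T_stat :: "real mat \<Rightarrow> real" where
  "T_stat A =
     (\<Sum>(i1, i2, i3) \<in> {(i1, i2, i3). {i1, i2, i3} \<subseteq> {..<dim_row A} \<and> distinct [i1, i2, i3]}.
        A_tilde A $$ (i1, i2) * A_tilde A $$ (i2, i3) * A_tilde A $$ (i3, i1))"

definition Q_stat :: "real mat \<Rightarrow> real" where
  "Q_stat A =
     (\<Sum>(i1, i2, i3, i4) \<in> {(i1, i2, i3, i4). {i1, i2, i3, i4} \<subseteq> {..<dim_row A} \<and>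
                                            distinct [i1, i2, i3, i4]}.
        A_tilde A $$ (i1, i2) * A_tilde A $$ (i2, i3) *
        A_tilde A $$ (i3, i4) * A_tilde A $$ (i4, i1))"


section \<open>A unit-cost real RAM\<close>

text \<open>
  The machine has index (natural number) and real registers, and two-dimensional index and
  real arrays; a one-dimensional array is the column 0 of a two-dimensional one. Reals cannot be
  converted to indices, and index arithmetic is addition only, so neither rounding nor packing
  of data into one large integer is available. The only literals are naturals and integers.
\<close>

type_synonym name = string

datatype iexp =
    IConst nat
  | IReg name
  | IArr name iexp iexp
  | IAdd iexp iexp

datatype rexp =
    RConst int
  | RReg name
  | RArr name iexp iexp
  | RAdd rexp rexp
  | RSub rexp rexp
  | RMul rexp rexp
  | RDiv rexp rexp

datatype test =
    ILess iexp iexp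
  | RLess rexp rexp
  | TNot test
  | TAnd test test

datatype com =
    SetIReg name iexp
  | SetIArr name iexp iexp iexp
  | SetRReg name rexp
  | SetRArr name iexp iexp rexp
  | Seq com com
  | If test com com
  | While test com

record state =
  ireg :: "name \<Rightarrow> nat"
  iarr :: "name \<Rightarrow> nat \<Rightarrow> nat \<Rightarrow> nat"
  rreg :: "name \<Rightarrow> real"
  rarr :: "name \<Rightarrow> nat \<Rightarrow> nat \<Rightarrow> real"

primrec ival :: "iexp \<Rightarrow> state \<Rightarrow> nat" where
  "ival (IConst k) s = k"
| "ival (IReg x) s = ireg s x"
| "ival (IArr a e f) s = iarr s a (ival e s) (ival f s)"
| "ival (IAdd e f) s = ival e s + ival f s"

text \<open>Division by zero returns 0, as in HOL; this gives no extra power, since tests against zero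
  are available at unit cost anyway.\<close>

primrec rval :: "rexp \<Rightarrow> state \<Rightarrow> real" where
  "rval (RConst k) s = of_int k"
| "rval (RReg x) s = rreg s x"
| "rval (RArr a e f) s = rarr s a (ival e s) (ival f s)"
| "rval (RAdd p q) s = rval p s + rval q s"
| "rval (RSub p q) s = rval p s - rval q s"
| "rval (RMul p q) s = rval p s * rval q s"
| "rval (RDiv p q) s = rval p s / rval q s"

primrec tval :: "test \<Rightarrow> state \<Rightarrow> bool" where
  "tval (ILess e f) s \<longleftrightarrow> ival e s < ival f s"
| "tval (RLess p q) s \<longleftrightarrow> rval p s < rval q s"
| "tval (TNot b) s \<longleftrightarrow> \<not> tval b s"
| "tval (TAnd b c) s \<longleftrightarrow> tval b s \<and> tval c s"

text \<open>
  Every node of an expression (arithmetic operation, comparison, memory access, literal) and every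
  assignment costs one unit. In particular the cost bounds the number of arithmetic operations
  performed. Index operations, comparisons and data movement are charged as well because
  arithmetic could otherwise be simulated by them free of charge.
\<close>

primrec icost :: "iexp \<Rightarrow> nat" where
  "icost (IConst k) = 1"
| "icost (IReg x) = 1"
| "icost (IArr a e f) = 1 + icost e + icost f"
| "icost (IAdd e f) = 1 + icost e + icost f"

primrec rcost :: "rexp \<Rightarrow> nat" where
  "rcost (RConst k) = 1"
| "rcost (RReg x) = 1"
| "rcost (RArr a e f) = 1 + icost e + icost f"
| "rcost (RAdd p q) = 1 + rcost p + rcost q"
| "rcost (RSub p q) = 1 + rcost p + rcost q"
| "rcost (RMul p q) = 1 + rcost p + rcost q"
| "rcost (RDiv p q) = 1 + rcost p + rcost q"

primrec tcost :: "test \<Rightarrow> nat" where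
  "tcost (ILess e f) = 1 + icost e + icost f"
| "tcost (RLess p q) = 1 + rcost p + rcost q"
| "tcost (TNot b) = 1 + tcost b"
| "tcost (TAnd b c) = 1 + tcost b + tcost c"

definition upd2 :: "(name \<Rightarrow> nat \<Rightarrow> nat \<Rightarrow> 'a) \<Rightarrow> name \<Rightarrow> nat \<Rightarrow> nat \<Rightarrow> 'a \<Rightarrow> (name \<Rightarrow> nat \<Rightarrow> nat \<Rightarrow> 'a)" where
  "upd2 m a i j v = m(a := (m a)(i := (m a i)(j := v)))"

text \<open>\<open>exec c s t s'\<close>: started in \<open>s\<close>, the program \<open>c\<close> terminates in \<open>s'\<close> at total cost \<open>t\<close>.\<close>

inductive exec :: "com \<Rightarrow> state \<Rightarrow> nat \<Rightarrow> state \<Rightarrow> bool" where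
  SetIReg: "exec (SetIReg x e) s (1 + icost e) (s\<lparr>ireg := (ireg s)(x := ival e s)\<rparr>)"
| SetIArr: "exec (SetIArr a e f g) s (1 + icost e + icost f + icost g)
              (s\<lparr>iarr := upd2 (iarr s) a (ival e s) (ival f s) (ival g s)\<rparr>)"
| SetRReg: "exec (SetRReg x p) s (1 + rcost p) (s\<lparr>rreg := (rreg s)(x := rval p s)\<rparr>)"
| SetRArr: "exec (SetRArr a e f p) s (1 + icost e + icost f + rcost p)
              (s\<lparr>rarr := upd2 (rarr s) a (ival e s) (ival f s) (rval p s)\<rparr>)"
| Seq: "exec c s t s' \<Longrightarrow> exec d s' u s'' \<Longrightarrow> exec (Seq c d) s (t + u) s''"
| IfTrue: "tval b s \<Longrightarrow> exec c s t s' \<Longrightarrow> exec (If b c d) s (tcost b + t) s'"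
| IfFalse: "\<not> tval b s \<Longrightarrow> exec d s t s' \<Longrightarrow> exec (If b c d) s (tcost b + t) s'"
| WhileFalse: "\<not> tval b s \<Longrightarrow> exec (While b c) s (tcost b) s"
| WhileTrue: "tval b s \<Longrightarrow> exec c s t s' \<Longrightarrow> exec (While b c) s' u s'' \<Longrightarrow>
                exec (While b c) s (tcost b + t + u) s''"

inductive_cases exec_elims:
  "exec (SetIReg x e) s t s'" "exec (SetIArr a e f g) s t s'"
  "exec (SetRReg x p) s t s'" "exec (SetRArr a e f p) s t s'"
  "exec (Seq c d) s t s'" "exec (If b c d) s t s'"

inductive_cases exec_WhileE: "exec (While b c) s t s'"

lemma exec_deterministic:
  "exec c s t s' \<Longrightarrow> exec c s u s'' \<Longrightarrow> t = u \<and> s' = s''"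
proof (induction arbitrary: u s'' rule: exec.induct)
  case (Seq c s t s' d u s'')
  then show ?case by (metis exec_elims(5))
next
  case (IfTrue b s c t s' d)
  then show ?case by (metis exec_elims(6))
next
  case (IfFalse b s d t s' c)
  then show ?case by (metis exec_elims(6))
next
  case (WhileFalse b s c)
  then show ?case by (metis exec_WhileE)
next
  case (WhileTrue b s c t s' u s'')
  then show ?case by (metis exec_WhileE)
qed (auto elim: exec_elims)


section \<open>Input of a network\<close>

text \<open>
  The network is given by adjacency lists, in arbitrary order. A dense \<open>n \<times> n\<close> input matrix would
  already take about \<open>n\<^sup>2\<close> memory accesses to scan, which is not \<open>O(n V)\<close> when \<open>V\<close>, the total
  degree, is smaller than \<open>n\<close>.
\<close>

definition adjacency_lists :: "nat \<Rightarrow> real mat \<Rightarrow> nat list list \<Rightarrow> bool" where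
  "adjacency_lists n A L \<longleftrightarrow>
     length L = n \<and>
     (\<forall>i<n. distinct (L ! i) \<and> set (L ! i) = {j. j < n \<and> A $$ (i, j) = 1})"

definition input_state :: "nat list list \<Rightarrow> state" where
  "input_state L = \<lparr>
     ireg = (\<lambda>_. 0)(''n'' := length L),
     iarr = (\<lambda>_ _ _. 0)(
       ''deg'' := (\<lambda>i k. if i < length L \<and> k = 0 then length (L ! i) else 0),
       ''nbr'' := (\<lambda>i k. if i < length L \<and> k < length (L ! i) then L ! i ! k else 0)),
     rreg = (\<lambda>_. 0),
     rarr = (\<lambda>_ _ _. 0)\<rparr>"

end

theory Submission
  imports Defs
begin

text \<open>
  Identities. Write \<open>b\<close> for the entries of \<open>A_tilde A\<close> and \<open>p\<close> for those of its square. The sum over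
  tuples of distinct indices is computed from the inside out: a sum over the indices that differ
  from a few given ones is the full sum minus finitely many terms, and the full innermost sum is an
  entry of the square. Repeating this with every index and collecting terms by means of the symmetry
  of \<open>b\<close> (\<open>sum_distinct_triples\<close>, \<open>sum_distinct_quadruples\<close>) expresses both statistics by \<open>b\<close> and
  \<open>p\<close> alone. This is inclusion-exclusion over the coincidence patterns of the indices on a closed
  walk; for four indices, each of the four triples that coincide and the pattern of all four equal
  enter with Moebius weights 2 and -6, which gives the coefficients 8 and -6. The matrix expressions
  of the theorem are the same sums (\<open>trace_formulas\<close>).

  Complexity. Let \<open>d\<close> be the degrees, \<open>V\<close> their sum. No square root is needed, because
  \<open>b i j = A i j - d i * d j / V\<close>. As \<open>A_tilde A\<close> is a sparse matrix minus one of rank one,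
  \<open>p i j = (\<Sum>k \<sim> i. b k j) - d i * (w j - S * d j / V) / V\<close>, where the sum ranges over the
  neighbours of \<open>i\<close>, \<open>w j\<close> is the sum of the degrees of the neighbours of \<open>j\<close>, and \<open>S\<close> is the sum
  of all squared degrees,
  so once \<open>d\<close>, \<open>w\<close>, \<open>S\<close> and \<open>V\<close> are known, an entry in row \<open>i\<close> of the square costs
  \<open>O(1 + d i)\<close> operations (\<open>p_eq\<close>). The rows of isolated nodes vanish in \<open>A_tilde A\<close> and in its
  square, and the program skips them. This matters when \<open>V\<close> is smaller than \<open>n\<close>: the other rows
  cost \<open>O(n * d i)\<close> each, hence \<open>O(n * V)\<close> in total, whereas visiting all pairs of nodes would
  already cost about \<open>n\<^sup>2\<close>. Finally \<open>n * V\<close> is the square of \<open>n\<close> times the average degree.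
\<close>

section \<open>Sums over pairwise distinct indices\<close>

lemma sum_diff_two:
  fixes f :: "'a \<Rightarrow> 'b::ab_group_add"
  assumes "finite S" "x \<in> S" "y \<in> S" "x \<noteq> y"
  shows "sum f (S - {x, y}) = sum f S - f x - f y"
  using assms by (simp add: sum_diff algebra_simps)

lemma sum_diff_three:
  fixes f :: "'a \<Rightarrow> 'b::ab_group_add"
  assumes "finite S" "x \<in> S" "y \<in> S" "z \<in> S" "x \<noteq> y" "x \<noteq> z" "y \<noteq> z"
  shows "sum f (S - {x, y, z}) = sum f S - f x - f y - f z"
  using assms by (simp add: sum_diff algebra_simps)

text \<open>
  Each of the three coincidences of two cyclically adjacent indices contributes \<open>b i i * p i i\<close>;
  triples of equal indices are counted once and subtracted three times, so they are added back
  twice.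
\<close>

lemma sum_distinct_triples:
  fixes b :: "'a \<Rightarrow> 'a \<Rightarrow> 'b::comm_ring_1"
  assumes S: "finite S" and sym: "\<And>i j. b i j = b j i"
  defines "p \<equiv> \<lambda>i j. \<Sum>k\<in>S. b i k * b k j"
  shows "(\<Sum>(i, j, k) \<in> {(i, j, k). {i, j, k} \<subseteq> S \<and> distinct [i, j, k]}. b i j * b j k * b k i)
    = (\<Sum>i\<in>S. \<Sum>j\<in>S. p i j * b i j) - 3 * (\<Sum>i\<in>S. b i i * p i i) + 2 * (\<Sum>i\<in>S. b i i ^ 3)"
proof -
  have set_eq: "{(i, j, k). {i, j, k} \<subseteq> S \<and> distinct [i, j, k]}
      = (SIGMA i:S. SIGMA j:S - {i}. S - {i, j})"
    by auto
  define F where "F i j = b i j * (p j i - b j i * b i i - b j j * b j i)" for i j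
  have p_sym: "p i j = p j i" for i j
    unfolding p_def by (intro sum.cong) (simp_all add: sym mult.commute)
  have inner: "(\<Sum>k\<in>S - {i, j}. b i j * b j k * b k i) = F i j"
    if "i \<in> S" "j \<in> S - {i}" for i j
  proof -
    have "(\<Sum>k\<in>S - {i, j}. b i j * b j k * b k i) = b i j * (\<Sum>k\<in>S - {i, j}. b j k * b k i)"
      by (simp add: sum_distrib_left mult.assoc)
    then show ?thesis
      using that S by (subst (asm) sum_diff_two) (auto simp: F_def p_def)
  qed
  have "(\<Sum>(i, j, k) \<in> {(i, j, k). {i, j, k} \<subseteq> S \<and> distinct [i, j, k]}. b i j * b j k * b k i)
      = (\<Sum>i\<in>S. \<Sum>j\<in>S - {i}. \<Sum>k\<in>S - {i, j}. b i j * b j k * b k i)"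
    unfolding set_eq using S by (simp add: sum.Sigma split_def)
  also have "\<dots> = (\<Sum>i\<in>S. \<Sum>j\<in>S - {i}. F i j)"
    by (intro sum.cong refl inner) auto
  also have "\<dots> = (\<Sum>i\<in>S. (\<Sum>j\<in>S. F i j) - F i i)"
    using S by (intro sum.cong refl) (simp add: sum_diff1)
  also have "\<dots> = (\<Sum>i\<in>S. \<Sum>j\<in>S. F i j) - (\<Sum>i\<in>S. F i i)"
    by (simp add: sum_subtractf)
  also have "(\<Sum>i\<in>S. \<Sum>j\<in>S. F i j) = (\<Sum>i\<in>S. \<Sum>j\<in>S. p i j * b i j)
      - (\<Sum>i\<in>S. b i i * p i i) - (\<Sum>i\<in>S. b i i * p i i)"
  proof -
    have "(\<Sum>i\<in>S. \<Sum>j\<in>S. F i j) = (\<Sum>i\<in>S. \<Sum>j\<in>S. p i j * b i j)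
        - (\<Sum>i\<in>S. \<Sum>j\<in>S. b i i * (b i j * b j i)) - (\<Sum>i\<in>S. \<Sum>j\<in>S. b j j * (b j i * b i j))"
      unfolding sum_subtractf[symmetric]
      by (intro sum.cong refl) (simp add: F_def sym p_sym algebra_simps)
    also have "(\<Sum>i\<in>S. \<Sum>j\<in>S. b j j * (b j i * b i j)) = (\<Sum>j\<in>S. \<Sum>i\<in>S. b j j * (b j i * b i j))"
      by (rule sum.swap)
    finally show ?thesis by (simp add: p_def sum_distrib_left)
  qed
  also have "(\<Sum>i\<in>S. F i i) = (\<Sum>i\<in>S. b i i * p i i) - 2 * (\<Sum>i\<in>S. b i i ^ 3)"
    unfolding sum_distrib_left sum_subtractf[symmetric]
    by (intro sum.cong refl) (simp add: F_def algebra_simps power3_eq_cube)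
  finally show ?thesis by (simp add: algebra_simps)
qed

text \<open>
  On a closed walk of length four, equality of two neighbouring indices leaves a loop and a closed
  walk of length three, while equality of two opposite indices leaves two closed walks of length two.
  Hence a single coincidence gives terms of two different shapes, \<open>b i i * (\<Sum>j\<in>S. p i j * b i j)\<close> and
  \<open>p i i ^ 2\<close>. So do two simultaneous coincidences of pairs: \<open>b i i * b i j ^ 2 * b j j\<close> if both are
  of neighbours, and \<open>b i j ^ 4\<close> if both are of opposite indices.
\<close>

lemma sum_distinct_quadruples:
  fixes b :: "'a \<Rightarrow> 'a \<Rightarrow> 'b::comm_ring_1"
  assumes S: "finite S" and sym: "\<And>i j. b i j = b j i"
  defines "p \<equiv> \<lambda>i j. \<Sum>k\<in>S. b i k * b k j"
  shows "(\<Sum>(i, j, k, l) \<in> {(i, j, k, l). {i, j, k, l} \<subseteq> S \<and> distinct [i, j, k, l]}.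
            b i j * b j k * b k l * b l i)
    = (\<Sum>i\<in>S. \<Sum>j\<in>S. p i j ^ 2) - 4 * (\<Sum>i\<in>S. b i i * (\<Sum>j\<in>S. p i j * b i j))
      + 8 * (\<Sum>i\<in>S. b i i ^ 2 * p i i) - 6 * (\<Sum>i\<in>S. b i i ^ 4) - 2 * (\<Sum>i\<in>S. p i i ^ 2)
      + 2 * (\<Sum>i\<in>S. \<Sum>j\<in>S. b i i * b i j ^ 2 * b j j) + (\<Sum>i\<in>S. \<Sum>j\<in>S. b i j ^ 4)"
proof -
  have set_eq: "{(i, j, k, l). {i, j, k, l} \<subseteq> S \<and> distinct [i, j, k, l]}
      = (SIGMA i:S. SIGMA j:S - {i}. SIGMA k:S - {i, j}. S - {i, j, k})"
    by auto
  have p_sym: "p i j = p j i" for i j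
    unfolding p_def by (intro sum.cong) (simp_all add: sym mult.commute)
  have p_diag: "(\<Sum>j\<in>S. b i j ^ 2) = p i i" for i
    unfolding p_def by (intro sum.cong) (simp_all add: sym power2_eq_square)
  define q where "q i = (\<Sum>j\<in>S. p i j * b i j)" for i
  \<comment> \<open>\<open>F\<close> and \<open>G\<close> are what remains after the sums over \<open>l\<close> and over \<open>k\<close>, respectively.\<close>
  define F where "F i j k = b i j * b j k * (p k i - b k i * b i i - b k j * b j i - b k k * b k i)"
    for i j k
  define G where "G i j = (\<Sum>k\<in>S. F i j k) - F i j i - F i j j" for i j
  have inner: "(\<Sum>l\<in>S - {i, j, k}. b i j * b j k * b k l * b l i) = F i j k"
    if "i \<in> S" "j \<in> S - {i}" "k \<in> S - {i, j}" for i j k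
  proof -
    have "(\<Sum>l\<in>S - {i, j, k}. b i j * b j k * b k l * b l i)
        = b i j * b j k * (\<Sum>l\<in>S - {i, j, k}. b k l * b l i)"
      by (simp add: sum_distrib_left mult.assoc)
    then show ?thesis
      using that S by (subst (asm) sum_diff_three) (auto simp: F_def p_def)
  qed
  have "(\<Sum>(i, j, k, l) \<in> {(i, j, k, l). {i, j, k, l} \<subseteq> S \<and> distinct [i, j, k, l]}.
            b i j * b j k * b k l * b l i)
      = (\<Sum>i\<in>S. \<Sum>j\<in>S - {i}. \<Sum>k\<in>S - {i, j}. \<Sum>l\<in>S - {i, j, k}. b i j * b j k * b k l * b l i)"
    unfolding set_eq using S by (simp add: sum.Sigma split_def)
  also have "\<dots> = (\<Sum>i\<in>S. \<Sum>j\<in>S - {i}. \<Sum>k\<in>S - {i, j}. F i j k)"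
    by (intro sum.cong refl inner) auto
  also have "\<dots> = (\<Sum>i\<in>S. \<Sum>j\<in>S - {i}. G i j)"
    unfolding G_def using S by (intro sum.cong refl sum_diff_two) auto
  also have "\<dots> = (\<Sum>i\<in>S. (\<Sum>j\<in>S. G i j) - G i i)"
    using S by (intro sum.cong refl) (simp add: sum_diff1)
  also have "\<dots> = (\<Sum>i\<in>S. \<Sum>j\<in>S. \<Sum>k\<in>S. F i j k) - (\<Sum>i\<in>S. \<Sum>j\<in>S. F i j i)
      - (\<Sum>i\<in>S. \<Sum>j\<in>S. F i j j) - (\<Sum>i\<in>S. \<Sum>k\<in>S. F i i k) + 2 * (\<Sum>i\<in>S. F i i i)"
    by (simp add: G_def sum_subtractf sum.distrib sum_distrib_left[symmetric] algebra_simps)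
  also have "(\<Sum>i\<in>S. \<Sum>j\<in>S. \<Sum>k\<in>S. F i j k)
      = (\<Sum>i\<in>S. \<Sum>j\<in>S. p i j ^ 2) - 2 * (\<Sum>i\<in>S. b i i * q i) - (\<Sum>i\<in>S. p i i ^ 2)"
  proof -
    \<comment> \<open>The sums of the four summands of \<open>F\<close>, each brought to the order in which an inner sum is an
      entry of the squared matrix.\<close>
    have "(\<Sum>i\<in>S. \<Sum>j\<in>S. \<Sum>k\<in>S. F i j k) = (\<Sum>i\<in>S. \<Sum>j\<in>S. \<Sum>k\<in>S. b i j * b j k * p k i)
        - (\<Sum>i\<in>S. \<Sum>j\<in>S. \<Sum>k\<in>S. b i j * b j k * b k i * b i i)
        - (\<Sum>i\<in>S. \<Sum>j\<in>S. \<Sum>k\<in>S. b j i ^ 2 * b j k ^ 2)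
        - (\<Sum>i\<in>S. \<Sum>j\<in>S. \<Sum>k\<in>S. b i j * b j k * b k i * b k k)"
      unfolding sum_subtractf[symmetric]
      by (intro sum.cong refl)
        (simp add: F_def sym p_sym algebra_simps power2_eq_square)
    also have "(\<Sum>i\<in>S. \<Sum>j\<in>S. \<Sum>k\<in>S. b i j * b j k * p k i) = (\<Sum>i\<in>S. \<Sum>k\<in>S. p i k ^ 2)"
    proof (rule sum.cong[OF refl])
      fix i
      have p_unfold: "p i k = (\<Sum>j\<in>S. b i j * b j k)" for i k by (simp add: p_def)
      have "(\<Sum>j\<in>S. \<Sum>k\<in>S. b i j * b j k * p k i) = (\<Sum>k\<in>S. \<Sum>j\<in>S. b i j * b j k * p k i)"
        by (rule sum.swap)
      also have "\<dots> = (\<Sum>k\<in>S. p i k * p k i)"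
        by (simp only: p_unfold[of i] sum_distrib_right)
      finally show "(\<Sum>j\<in>S. \<Sum>k\<in>S. b i j * b j k * p k i) = (\<Sum>k\<in>S. p i k ^ 2)"
        by (simp add: power2_eq_square p_sym[of _ i])
    qed
    also have "(\<Sum>i\<in>S. \<Sum>j\<in>S. \<Sum>k\<in>S. b i j * b j k * b k i * b i i) = (\<Sum>i\<in>S. b i i * q i)"
    proof (intro sum.cong refl)
      fix i
      have "(\<Sum>j\<in>S. \<Sum>k\<in>S. b i j * b j k * b k i * b i i)
          = (\<Sum>k\<in>S. \<Sum>j\<in>S. b i j * b j k * b k i * b i i)"
        by (rule sum.swap)
      also have "\<dots> = (\<Sum>k\<in>S. p i k * b k i * b i i)"
        by (simp add: p_def sum_distrib_right)
      finally show "(\<Sum>j\<in>S. \<Sum>k\<in>S. b i j * b j k * b k i * b i i) = b i i * q i"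
        by (simp add: q_def sum_distrib_left sym mult_ac)
    qed
    also have "(\<Sum>i\<in>S. \<Sum>j\<in>S. \<Sum>k\<in>S. b j i ^ 2 * b j k ^ 2) = (\<Sum>j\<in>S. p j j ^ 2)"
      by (subst sum.swap) (simp add: p_diag[symmetric] power2_eq_square[of "sum _ _"] sum_product)
    also have "(\<Sum>i\<in>S. \<Sum>j\<in>S. \<Sum>k\<in>S. b i j * b j k * b k i * b k k) = (\<Sum>k\<in>S. b k k * q k)"
    proof -
      have "(\<Sum>i\<in>S. \<Sum>j\<in>S. \<Sum>k\<in>S. b i j * b j k * b k i * b k k)
          = (\<Sum>i\<in>S. \<Sum>k\<in>S. \<Sum>j\<in>S. b i j * b j k * b k i * b k k)"
        by (intro sum.cong refl sum.swap)
      also have "\<dots> = (\<Sum>i\<in>S. \<Sum>k\<in>S. p i k * b k i * b k k)"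
        by (simp add: p_def sum_distrib_right)
      also have "\<dots> = (\<Sum>k\<in>S. \<Sum>i\<in>S. p i k * b k i * b k k)"
        by (rule sum.swap)
      also have "\<dots> = (\<Sum>k\<in>S. b k k * q k)"
        unfolding q_def sum_distrib_left by (intro sum.cong refl) (simp add: p_sym mult_ac)
      finally show ?thesis .
    qed
    finally show ?thesis by simp
  qed
  also have "(\<Sum>i\<in>S. \<Sum>j\<in>S. F i j i) = (\<Sum>i\<in>S. p i i ^ 2) - 2 * (\<Sum>i\<in>S. b i i ^ 2 * p i i)
      - (\<Sum>i\<in>S. \<Sum>j\<in>S. b i j ^ 4)"
  proof -
    have "F i j i = b i j ^ 2 * p i i - 2 * (b i i ^ 2 * b i j ^ 2) - b i j ^ 4" for i j
      by (simp add: F_def sym algebra_simps power2_eq_square power4_eq_xxxx)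
    then show ?thesis
      by (simp add: sum_subtractf sum_distrib_left[symmetric] sum_distrib_right[symmetric] p_diag
          power2_eq_square[of "p _ _"])
  qed
  also have "(\<Sum>i\<in>S. \<Sum>j\<in>S. F i j j) = (\<Sum>j\<in>S. b j j * q j)
      - (\<Sum>i\<in>S. \<Sum>j\<in>S. b i i * b i j ^ 2 * b j j) - 2 * (\<Sum>j\<in>S. b j j ^ 2 * p j j)"
  proof -
    have F: "F i j j = b j j * (p j i * b j i) - b i i * b i j ^ 2 * b j j - 2 * (b j j ^ 2 * b j i ^ 2)"
      for i j
      by (simp add: F_def sym algebra_simps power2_eq_square)
    have "(\<Sum>i\<in>S. \<Sum>j\<in>S. F i j j) = (\<Sum>i\<in>S. \<Sum>j\<in>S. b j j * (p j i * b j i))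
        - (\<Sum>i\<in>S. \<Sum>j\<in>S. b i i * b i j ^ 2 * b j j) - (\<Sum>i\<in>S. \<Sum>j\<in>S. 2 * (b j j ^ 2 * b j i ^ 2))"
      by (simp add: F sum_subtractf)
    also have "(\<Sum>i\<in>S. \<Sum>j\<in>S. b j j * (p j i * b j i)) = (\<Sum>j\<in>S. b j j * q j)"
      by (subst sum.swap) (simp add: q_def sum_distrib_left)
    also have "(\<Sum>i\<in>S. \<Sum>j\<in>S. 2 * (b j j ^ 2 * b j i ^ 2)) = 2 * (\<Sum>j\<in>S. b j j ^ 2 * p j j)"
      by (subst sum.swap) (simp add: p_diag[symmetric] sum_distrib_left)
    finally show ?thesis .
  qed
  also have "(\<Sum>i\<in>S. \<Sum>k\<in>S. F i i k) = (\<Sum>i\<in>S. b i i * q i)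
      - 2 * (\<Sum>i\<in>S. b i i ^ 2 * p i i) - (\<Sum>i\<in>S. \<Sum>j\<in>S. b i i * b i j ^ 2 * b j j)"
  proof -
    have "F i i k = b i i * (p i k * b i k) - 2 * (b i i ^ 2 * b i k ^ 2) - b i i * b i k ^ 2 * b k k"
      for i k
      by (simp add: F_def sym p_sym algebra_simps power2_eq_square)
    then show ?thesis
      by (simp add: sum_subtractf sum_distrib_left[symmetric] p_diag q_def)
  qed
  also have "(\<Sum>i\<in>S. F i i i) = (\<Sum>i\<in>S. b i i ^ 2 * p i i) - 3 * (\<Sum>i\<in>S. b i i ^ 4)"
    unfolding sum_distrib_left sum_subtractf[symmetric]
    by (intro sum.cong refl) (simp add: F_def algebra_simps power2_eq_square power4_eq_xxxx)
  finally show ?thesis by (simp add: q_def algebra_simps)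
qed

section \<open>Traces and entrywise products as sums\<close>

lemma index_mult_mat_sum:
  assumes "M \<in> carrier_mat n n" "N \<in> carrier_mat n n" "i < n" "j < n"
  shows "(M * N) $$ (i, j) = (\<Sum>k<n. M $$ (i, k) * N $$ (k, j))"
  using assms by (simp add: scalar_prod_def atLeast0LessThan)

lemma ones_quadratic_form:
  assumes "M \<in> carrier_mat n n"
  shows "ones_vec n \<bullet> (M *\<^sub>v ones_vec n) = (\<Sum>i<n. \<Sum>j<n. M $$ (i, j))"
  using assms by (simp add: ones_vec_def scalar_prod_def atLeast0LessThan)

lemma diag_sandwich_index:
  assumes "B \<in> carrier_mat n n" "M \<in> carrier_mat n n" "i < n" "j < n"
  shows "(diag_part B * M * diag_part B) $$ (i, j) = B $$ (i, i) * M $$ (i, j) * B $$ (j, j)"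
  using assms
  by (subst index_mult_mat_sum[of _ n], simp_all add: diag_part_def mat_diag_mult_left)
     (simp add: mat_diag_def if_distrib[of "\<lambda>x. _ * x"] cong: if_cong)

text \<open>
  By symmetry, powers up to the fourth need only the entries \<open>p\<close> of the square: a diagonal entry of the
  cube is the inner product of a row of the square with a row of \<open>B\<close>, and the trace of the fourth power
  is the squared Frobenius norm of the square.
\<close>

lemma trace_formulas:
  fixes B :: "real mat" and n :: nat
  assumes B: "B \<in> carrier_mat n n" and symmetric: "\<forall>i<n. \<forall>j<n. B $$ (i, j) = B $$ (j, i)"
  defines "p \<equiv> \<lambda>i j. \<Sum>k<n. B $$ (i, k) * B $$ (k, j)"
  shows "trace_mat (B ^\<^sub>m 3) = (\<Sum>i<n. \<Sum>j<n. p i j * B $$ (i, j))"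
    and "trace_mat (B ^\<^sub>m 4) = (\<Sum>i<n. \<Sum>j<n. p i j ^ 2)"
    and "trace_mat (B \<circ>\<^sub>H B ^\<^sub>m 2) = (\<Sum>i<n. B $$ (i, i) * p i i)"
    and "trace_mat (B \<circ>\<^sub>H B ^\<^sub>m 3) = (\<Sum>i<n. B $$ (i, i) * (\<Sum>j<n. p i j * B $$ (i, j)))"
    and "trace_mat (B \<circ>\<^sub>H B \<circ>\<^sub>H B ^\<^sub>m 2) = (\<Sum>i<n. B $$ (i, i) ^ 2 * p i i)"
    and "trace_mat (B ^\<^sub>m 2 \<circ>\<^sub>H B ^\<^sub>m 2) = (\<Sum>i<n. p i i ^ 2)"
    and "trace_mat (B \<circ>\<^sub>H B \<circ>\<^sub>H B) = (\<Sum>i<n. B $$ (i, i) ^ 3)"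
    and "trace_mat (B \<circ>\<^sub>H B \<circ>\<^sub>H B \<circ>\<^sub>H B) = (\<Sum>i<n. B $$ (i, i) ^ 4)"
    and "ones_vec n \<bullet> ((diag_part B * (B \<circ>\<^sub>H B) * diag_part B) *\<^sub>v ones_vec n)
      = (\<Sum>i<n. \<Sum>j<n. B $$ (i, i) * B $$ (i, j) ^ 2 * B $$ (j, j))"
    and "ones_vec n \<bullet> ((B \<circ>\<^sub>H B \<circ>\<^sub>H B \<circ>\<^sub>H B) *\<^sub>v ones_vec n) = (\<Sum>i<n. \<Sum>j<n. B $$ (i, j) ^ 4)"
proof -
  note sym = symmetric[rule_format]
  have pow2: "B ^\<^sub>m 2 = B * B" and pow3: "B ^\<^sub>m 3 = B * B * B"
    using B by (simp_all add: numeral_2_eq_2 numeral_3_eq_3)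
  have pow4: "B ^\<^sub>m 4 = (B * B) * (B * B)"
    using B by (simp add: eval_nat_numeral assoc_mult_mat[of _ n n _ n _ n])
  have BB: "B * B \<in> carrier_mat n n" using B by simp
  have p: "(B * B) $$ (i, j) = p i j" if "i < n" "j < n" for i j
    using index_mult_mat_sum[OF B B that] by (simp add: p_def)
  have p_sym: "p i j = p j i" if "i < n" "j < n" for i j
    using that by (simp add: p_def sym[of i] sym[of _ j] mult.commute)
  have q: "(B * B * B) $$ (i, i) = (\<Sum>j<n. p i j * B $$ (i, j))" if "i < n" for i
    using that sym by (simp add: index_mult_mat_sum[OF BB B] p)
  have r: "((B * B) * (B * B)) $$ (i, i) = (\<Sum>j<n. p i j ^ 2)" if "i < n" for i
    using that p_sym by (simp add: index_mult_mat_sum[OF BB BB] p power2_eq_square)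
  have dim: "dim_row B = n" "dim_col B = n" using B by auto
  show "trace_mat (B ^\<^sub>m 3) = (\<Sum>i<n. \<Sum>j<n. p i j * B $$ (i, j))"
    by (simp add: trace_mat_def pow3 dim q del: index_mult_mat(1))
  show "trace_mat (B ^\<^sub>m 4) = (\<Sum>i<n. \<Sum>j<n. p i j ^ 2)"
    by (simp add: trace_mat_def pow4 dim r del: index_mult_mat(1))
  show "trace_mat (B \<circ>\<^sub>H B ^\<^sub>m 2) = (\<Sum>i<n. B $$ (i, i) * p i i)"
    by (simp add: trace_mat_def hadamard_def pow2 dim p del: index_mult_mat(1))
  show "trace_mat (B \<circ>\<^sub>H B ^\<^sub>m 3) = (\<Sum>i<n. B $$ (i, i) * (\<Sum>j<n. p i j * B $$ (i, j)))"
    by (simp add: trace_mat_def hadamard_def pow3 dim q del: index_mult_mat(1))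
  show "trace_mat (B \<circ>\<^sub>H B \<circ>\<^sub>H B ^\<^sub>m 2) = (\<Sum>i<n. B $$ (i, i) ^ 2 * p i i)"
    by (simp add: trace_mat_def hadamard_def pow2 dim p power2_eq_square del: index_mult_mat(1))
  show "trace_mat (B ^\<^sub>m 2 \<circ>\<^sub>H B ^\<^sub>m 2) = (\<Sum>i<n. p i i ^ 2)"
    by (simp add: trace_mat_def hadamard_def pow2 dim p power2_eq_square del: index_mult_mat(1))
  show "trace_mat (B \<circ>\<^sub>H B \<circ>\<^sub>H B) = (\<Sum>i<n. B $$ (i, i) ^ 3)"
    by (simp add: trace_mat_def hadamard_def dim power3_eq_cube)
  show "trace_mat (B \<circ>\<^sub>H B \<circ>\<^sub>H B \<circ>\<^sub>H B) = (\<Sum>i<n. B $$ (i, i) ^ 4)"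
    by (simp add: trace_mat_def hadamard_def dim power4_eq_xxxx)
  have H: "B \<circ>\<^sub>H B \<in> carrier_mat n n" "B \<circ>\<^sub>H B \<circ>\<^sub>H B \<circ>\<^sub>H B \<in> carrier_mat n n"
    "diag_part B * (B \<circ>\<^sub>H B) * diag_part B \<in> carrier_mat n n"
    by (auto simp: hadamard_def dim diag_part_def mat_diag_def)
  show "ones_vec n \<bullet> ((diag_part B * (B \<circ>\<^sub>H B) * diag_part B) *\<^sub>v ones_vec n)
      = (\<Sum>i<n. \<Sum>j<n. B $$ (i, i) * B $$ (i, j) ^ 2 * B $$ (j, j))"
    by (simp add: ones_quadratic_form[OF H(3)] diag_sandwich_index[OF B H(1)] del: index_mult_mat(1))
       (simp add: hadamard_def dim power2_eq_square)
  show "ones_vec n \<bullet> ((B \<circ>\<^sub>H B \<circ>\<^sub>H B \<circ>\<^sub>H B) *\<^sub>v ones_vec n) = (\<Sum>i<n. \<Sum>j<n. B $$ (i, j) ^ 4)"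
    by (simp add: ones_quadratic_form[OF H(2)]) (simp add: hadamard_def dim power4_eq_xxxx)
qed

lemma A_tilde_carrier: "adjacency_mat n A \<Longrightarrow> A_tilde A \<in> carrier_mat n n"
  by (auto simp: A_tilde_def outer_prod_def eta_hat_def adjacency_mat_def)

lemma A_tilde_sym:
  assumes "adjacency_mat n A"
  shows "\<forall>i<n. \<forall>j<n. A_tilde A $$ (i, j) = A_tilde A $$ (j, i)"
proof (intro allI impI)
  fix i j assume ij: "i < n" "j < n"
  have A: "A \<in> carrier_mat n n" "A\<^sup>T = A" using assms by (auto simp: adjacency_mat_def)
  then have "A $$ (i, j) = A $$ (j, i)" using ij index_transpose_mat(1)[of j A i] by auto
  then show "A_tilde A $$ (i, j) = A_tilde A $$ (j, i)"
    using A ij by (simp add: A_tilde_def outer_prod_def eta_hat_def mult.commute)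
qed

lemma T_stat_eq_sums:
  assumes "adjacency_mat n A"
  defines "B \<equiv> A_tilde A"
  shows "T_stat A = (\<Sum>i<n. \<Sum>j<n. (\<Sum>k<n. B $$ (i, k) * B $$ (k, j)) * B $$ (i, j))
    - 3 * (\<Sum>i<n. B $$ (i, i) * (\<Sum>k<n. B $$ (i, k) * B $$ (k, i))) + 2 * (\<Sum>i<n. B $$ (i, i) ^ 3)"
proof -
  \<comment> \<open>Outside the matrix \<open>B $$ (i, j)\<close> is unspecified; cutting it off makes \<open>b\<close> symmetric everywhere.\<close>
  define b where "b i j = (if i < n \<and> j < n then B $$ (i, j) else 0)" for i j
  have b_sym: "b i j = b j i" for i j
    using A_tilde_sym[OF assms(1)] by (simp add: b_def B_def)
  have n: "dim_row A = n" using assms(1) by (auto simp: adjacency_mat_def)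
  have "T_stat A = (\<Sum>(i, j, k) \<in> {(i, j, k). {i, j, k} \<subseteq> {..<n} \<and> distinct [i, j, k]}.
      b i j * b j k * b k i)"
    unfolding T_stat_def n by (intro sum.cong refl) (auto simp: b_def B_def)
  also note sum_distinct_triples[of "{..<n}" b, OF finite_lessThan b_sym]
  finally show ?thesis by (simp add: b_def)
qed

lemma Q_stat_eq_sums:
  assumes "adjacency_mat n A"
  defines "B \<equiv> A_tilde A"
  shows "Q_stat A = (\<Sum>i<n. \<Sum>j<n. (\<Sum>k<n. B $$ (i, k) * B $$ (k, j)) ^ 2)
    - 4 * (\<Sum>i<n. B $$ (i, i) * (\<Sum>j<n. (\<Sum>k<n. B $$ (i, k) * B $$ (k, j)) * B $$ (i, j)))
    + 8 * (\<Sum>i<n. B $$ (i, i) ^ 2 * (\<Sum>k<n. B $$ (i, k) * B $$ (k, i)))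
    - 6 * (\<Sum>i<n. B $$ (i, i) ^ 4) - 2 * (\<Sum>i<n. (\<Sum>k<n. B $$ (i, k) * B $$ (k, i)) ^ 2)
    + 2 * (\<Sum>i<n. \<Sum>j<n. B $$ (i, i) * B $$ (i, j) ^ 2 * B $$ (j, j))
    + (\<Sum>i<n. \<Sum>j<n. B $$ (i, j) ^ 4)"
proof -
  define b where "b i j = (if i < n \<and> j < n then B $$ (i, j) else 0)" for i j
  have b_sym: "b i j = b j i" for i j
    using A_tilde_sym[OF assms(1)] by (simp add: b_def B_def)
  have n: "dim_row A = n" using assms(1) by (auto simp: adjacency_mat_def)
  have "Q_stat A = (\<Sum>(i, j, k, l) \<in> {(i, j, k, l). {i, j, k, l} \<subseteq> {..<n} \<and> distinct [i, j, k, l]}.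
      b i j * b j k * b k l * b l i)"
    unfolding Q_stat_def n by (intro sum.cong refl) (auto simp: b_def B_def)
  also note sum_distinct_quadruples[of "{..<n}" b, OF finite_lessThan b_sym]
  finally show ?thesis by (simp add: b_def)
qed

section \<open>Counting loops on the machine\<close>

abbreviation set_ireg :: "name \<Rightarrow> nat \<Rightarrow> state \<Rightarrow> state" where
  "set_ireg x v s \<equiv> s\<lparr>ireg := (ireg s)(x := v)\<rparr>"

abbreviation set_rreg :: "name \<Rightarrow> real \<Rightarrow> state \<Rightarrow> state" where
  "set_rreg x v s \<equiv> s\<lparr>rreg := (rreg s)(x := v)\<rparr>"

text \<open>
  A total-correctness judgement for a single initial state, with an upper bound on the cost. In the
  rules below the bound is built up from those of the parts, so that it can be left schematic while a
  program is decomposed; \<open>runs_weaken\<close> compares it with the intended bound at the end.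
\<close>

definition runs :: "com \<Rightarrow> state \<Rightarrow> nat \<Rightarrow> (state \<Rightarrow> bool) \<Rightarrow> bool" where
  "runs c s k Q \<longleftrightarrow> (\<exists>t s'. exec c s t s' \<and> t \<le> k \<and> Q s')"

lemma runs_mono: "runs c s k Q \<Longrightarrow> k \<le> K \<Longrightarrow> (\<And>s'. Q s' \<Longrightarrow> R s') \<Longrightarrow> runs c s K R"
  unfolding runs_def by (meson le_trans)

lemma runs_weaken: "runs c s k Q \<Longrightarrow> k \<le> K \<Longrightarrow> runs c s K Q"
  by (rule runs_mono)

lemma runs_Seq: "runs c s k (\<lambda>s'. runs d s' l Q) \<Longrightarrow> runs (Seq c d) s (k + l) Q"
  unfolding runs_def by (meson add_mono exec.Seq)

lemma runs_SetIReg: "Q (set_ireg x (ival e s) s) \<Longrightarrow> runs (SetIReg x e) s (1 + icost e) Q"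
  unfolding runs_def by (blast intro: exec.SetIReg)

lemma runs_SetRReg: "Q (set_rreg x (rval p s) s) \<Longrightarrow> runs (SetRReg x p) s (1 + rcost p) Q"
  unfolding runs_def by (blast intro: exec.SetRReg)

lemma runs_SetRArr:
  "Q (s\<lparr>rarr := upd2 (rarr s) a (ival e s) (ival f s) (rval p s)\<rparr>) \<Longrightarrow>
    runs (SetRArr a e f p) s (1 + icost e + icost f + rcost p) Q"
  unfolding runs_def by (blast intro: exec.SetRArr)

text \<open>
  Each use of \<open>runs_SetRReg\<close> copies the state into the new value, so that the state after several
  assignments grows exponentially. Here the new value is given in closed form, and the state stays one
  update of each kind of register on top of a fixed state.
\<close>

lemma runs_SetRReg_value:
  assumes "rval p (s\<lparr>rreg := f, ireg := g\<rparr>) = v" "Q (s\<lparr>rreg := f(x := v), ireg := g\<rparr>)"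
  shows "runs (SetRReg x p) (s\<lparr>rreg := f, ireg := g\<rparr>) (1 + rcost p) Q"
proof (rule runs_SetRReg)
  show "Q (set_rreg x (rval p (s\<lparr>rreg := f, ireg := g\<rparr>)) (s\<lparr>rreg := f, ireg := g\<rparr>))"
    using assms by (cases s) simp
qed

lemma runs_If:
  assumes "tval b s \<Longrightarrow> runs c s k Q" "\<not> tval b s \<Longrightarrow> runs d s k Q"
  shows "runs (If b c d) s (tcost b + k) Q"
  using assms unfolding runs_def
  by (cases "tval b s") (meson add_le_mono1 add_left_mono exec.IfTrue exec.IfFalse)+

definition for_loop :: "name \<Rightarrow> iexp \<Rightarrow> com \<Rightarrow> com" where
  "for_loop x e c = Seq (SetIReg x (IConst 0))
     (While (ILess (IReg x) e) (Seq c (SetIReg x (IAdd (IReg x) (IConst 1)))))"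

text \<open>
  The invariant \<open>I k\<close> describes the states with counter value \<open>k\<close>. Each iteration pays for its body,
  for the test (2 plus the cost of the bound) and for the increment (4).
\<close>

lemma runs_for_loop:
  assumes inv: "\<And>k s. I k s \<Longrightarrow> ireg s x = k \<and> ival e s = N"
    and start: "I 0 (set_ireg x 0 s)"
    and step: "\<And>k s. k < N \<Longrightarrow> I k s \<Longrightarrow> runs c s (t k) (\<lambda>s'. I (Suc k) (set_ireg x (Suc (ireg s' x)) s'))"
    and final: "\<And>s. I N s \<Longrightarrow> Q s"
  shows "runs (for_loop x e c) s ((\<Sum>k<N. t k) + N * (6 + icost e) + (4 + icost e)) Q"
proof -
  let ?while = "While (ILess (IReg x) e) (Seq c (SetIReg x (IAdd (IReg x) (IConst 1))))"
  have while: "\<forall>s. I k s \<longrightarrow> runs ?while s ((\<Sum>j=k..<N. t j) + (N - k) * (6 + icost e) + (2 + icost e)) (I N)"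
    if "k \<le> N" for k
    using that
  proof (induction k rule: inc_induct)
    case base
    show ?case
    proof (intro allI impI)
      fix s assume "I N s"
      then have "exec ?while s (tcost (ILess (IReg x) e)) s"
        using inv[of N s] by (intro exec.WhileFalse) simp
      with \<open>I N s\<close> show "runs ?while s ((\<Sum>j=N..<N. t j) + (N - N) * (6 + icost e) + (2 + icost e)) (I N)"
        unfolding runs_def by (intro exI[of _ "tcost (ILess (IReg x) e)"] exI[of _ s]) simp
    qed
  next
    case (step k)
    show ?case
    proof (intro allI impI)
      fix s assume I: "I k s"
      obtain u s1 where 1: "exec c s u s1" "u \<le> t k" "I (Suc k) (set_ireg x (Suc (ireg s1 x)) s1)"
        using assms(3)[OF step(2) I] unfolding runs_def by blast
      let ?s2 = "set_ireg x (Suc (ireg s1 x)) s1"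
      obtain v s3 where 2: "exec ?while ?s2 v s3" "I N s3"
        "v \<le> (\<Sum>j=Suc k..<N. t j) + (N - Suc k) * (6 + icost e) + (2 + icost e)"
        using step(3) 1(3) unfolding runs_def by blast
      have incr: "exec (SetIReg x (IAdd (IReg x) (IConst 1))) s1 4 ?s2"
        using exec.SetIReg[of x "IAdd (IReg x) (IConst 1)" s1] by (simp add: numeral_eq_Suc)
      have "exec ?while s (tcost (ILess (IReg x) e) + (u + 4) + v) s3"
        using inv[OF I] step(2) by (intro exec.WhileTrue[OF _ exec.Seq[OF 1(1) incr] 2(1)]) simp
      moreover have "tcost (ILess (IReg x) e) + (u + 4) + v
          \<le> (\<Sum>j=k..<N. t j) + (N - k) * (6 + icost e) + (2 + icost e)"
        using 1(2) 2(3) step(2)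
        by (simp add: sum.atLeast_Suc_lessThan[of k N] Suc_diff_Suc[symmetric])
      ultimately show "runs ?while s ((\<Sum>j=k..<N. t j) + (N - k) * (6 + icost e) + (2 + icost e)) (I N)"
        using 2(2) unfolding runs_def by blast
    qed
  qed
  have "runs (for_loop x e c) s ((1 + icost (IConst 0)) + ((\<Sum>j=0..<N. t j) + (N - 0) * (6 + icost e) + (2 + icost e))) Q"
    unfolding for_loop_def
  proof (intro runs_Seq runs_SetIReg)
    show "runs ?while (set_ireg x (ival (IConst 0) s) s)
        ((\<Sum>j=0..<N. t j) + (N - 0) * (6 + icost e) + (2 + icost e)) Q"
      using while[of 0] start by (auto intro: runs_mono final)
  qed
  then show ?thesis
    by (rule runs_weaken) (simp add: atLeast0LessThan)
qed

text \<open>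
  By convention the register \<open>i\<close> holds the node whose neighbours are traversed, and \<open>m\<close> the position in
  its adjacency list.
\<close>

definition degree_of :: "iexp \<Rightarrow> iexp" where
  "degree_of v = IArr ''deg'' v (IConst 0)"

definition neighbour :: iexp where
  "neighbour = IArr ''nbr'' (IReg ''i'') (IReg ''m'')"

definition neighbour_sum :: "name \<Rightarrow> rexp \<Rightarrow> com" where
  "neighbour_sum x p = Seq (SetRReg x (RConst 0))
     (for_loop ''m'' (degree_of (IReg ''i'')) (SetRReg x (RAdd (RReg x) p)))"

text \<open>
  The resulting state is given exactly, because callers go on using all other registers and arrays.
\<close>

lemma runs_neighbour_sum:
  assumes deg: "iarr s ''deg'' (ireg s ''i'') 0 = D"
    and val: "\<And>m v. m < D \<Longrightarrow> rval p (set_ireg ''m'' m (set_rreg x v s)) = f m"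
    and Q: "Q (set_ireg ''m'' D (set_rreg x (\<Sum>m<D. f m) s))"
  shows "runs (neighbour_sum x p) s (D * (12 + rcost p) + 9) Q"
proof -
  define I where "I k s' \<longleftrightarrow> s' = set_ireg ''m'' k (set_rreg x (\<Sum>m<k. f m) s)" for k s'
  have "runs (neighbour_sum x p) s (1 + rcost (RConst 0)
      + ((\<Sum>k<D. 3 + rcost p) + D * (6 + icost (degree_of (IReg ''i''))) + (4 + icost (degree_of (IReg ''i''))))) Q"
    unfolding neighbour_sum_def
  proof (intro runs_Seq runs_SetRReg, rule runs_for_loop[of I])
    show "runs (SetRReg x (RAdd (RReg x) p)) s' (3 + rcost p)
        (\<lambda>s''. I (Suc k) (set_ireg ''m'' (Suc (ireg s'' ''m'')) s''))" if "k < D" "I k s'" for k s'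
    proof (rule runs_weaken[OF runs_SetRReg])
      show "I (Suc k) (set_ireg ''m'' (Suc (ireg (set_rreg x (rval (RAdd (RReg x) p) s') s') ''m''))
          (set_rreg x (rval (RAdd (RReg x) p) s') s'))"
        using that val[OF that(1)] by (simp add: I_def)
    qed simp
  qed (use deg Q in \<open>auto simp: I_def degree_of_def\<close>)
  then show ?thesis
    by (rule runs_weaken) (simp add: degree_of_def algebra_simps)
qed

section \<open>The program\<close>

text \<open>
  Only the ones are written: memory is initially zero, and clearing the array would take about
  \<open>n\<^sup>2\<close> steps.
\<close>

definition load_matrix :: com where
  "load_matrix = for_loop ''i'' (IReg ''n'') (for_loop ''m'' (degree_of (IReg ''i''))
     (SetRArr ''A'' (IReg ''i'') neighbour (RConst 1)))"

text \<open>
  The input stores the degrees as indices, which cannot be converted to reals. Hence a real degree is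
  obtained by counting neighbours. \<open>V\<close> becomes the sum of the degrees and \<open>S\<close> that of their squares.
\<close>

definition compute_degrees :: com where
  "compute_degrees = Seq (SetRReg ''V'' (RConst 0)) (Seq (SetRReg ''S'' (RConst 0))
     (for_loop ''i'' (IReg ''n'')
       (Seq (neighbour_sum ''x'' (RConst 1))
       (Seq (SetRArr ''D'' (IReg ''i'') (IConst 0) (RReg ''x''))
       (Seq (SetRReg ''V'' (RAdd (RReg ''V'') (RReg ''x'')))
            (SetRReg ''S'' (RAdd (RReg ''S'') (RMul (RReg ''x'') (RReg ''x'')))))))))"

text \<open>
  The product of the adjacency matrix with the vector of degrees, called \<open>w\<close> below.
\<close>

definition compute_degree_image :: com where
  "compute_degree_image = for_loop ''i'' (IReg ''n'')
     (Seq (neighbour_sum ''x'' (RArr ''D'' neighbour (IConst 0)))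
          (SetRArr ''W'' (IReg ''i'') (IConst 0) (RReg ''x'')))"

text \<open>
  If \<open>r\<close> evaluates to the entry of the adjacency matrix at the nodes \<open>v\<close> and \<open>w\<close>, this is the entry of
  \<open>A_tilde A\<close>. On the diagonal \<open>r\<close> is the constant 0.
\<close>

definition centred :: "rexp \<Rightarrow> iexp \<Rightarrow> iexp \<Rightarrow> rexp" where
  "centred r v w = RSub r (RDiv (RMul (RArr ''D'' v (IConst 0)) (RArr ''D'' w (IConst 0))) (RReg ''V''))"

text \<open>
  Afterwards \<open>x\<close> and \<open>y\<close> hold the entries at \<open>(i, j)\<close> of \<open>A_tilde A\<close> and of its square, and \<open>bi\<close> and
  \<open>bj\<close> the diagonal entries of \<open>A_tilde A\<close> at \<open>i\<close> and \<open>j\<close>. What depends on \<open>j\<close> is added to the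
  statistics here. The diagonal entry of the square at \<open>i\<close> is the sum of the squares of the entries in
  row \<open>i\<close> of \<open>A_tilde A\<close>; it is accumulated in \<open>R\<close>.
\<close>

definition entry_step :: com where
  "entry_step =
    (let i = IReg ''i''; j = IReg ''j''; x = RReg ''x''; y = RReg ''y''; xx = RReg ''xx'';
         bi = RReg ''bi''; bj = RReg ''bj'' in
     Seq (SetRReg ''x'' (centred (RArr ''A'' i j) i j))
    (Seq (neighbour_sum ''y'' (centred (RArr ''A'' neighbour j) neighbour j))
    (Seq (SetRReg ''y'' (RSub y (RDiv (RMul (RArr ''D'' i (IConst 0))
            (RSub (RArr ''W'' j (IConst 0)) (RDiv (RMul (RReg ''S'') (RArr ''D'' j (IConst 0))) (RReg ''V''))))
            (RReg ''V''))))
    (Seq (SetRReg ''bj'' (centred (RConst 0) j j))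
    (Seq (SetRReg ''xx'' (RMul x x))
    (Seq (SetRReg ''T'' (RAdd (RReg ''T'') (RMul y x)))
    (Seq (SetRReg ''Q'' (RAdd (RReg ''Q'')
            (RAdd (RSub (RMul y y) (RMul (RConst 4) (RMul bi (RMul y x))))
                  (RMul xx (RAdd xx (RMul (RConst 2) (RMul bi bj)))))))
         (SetRReg ''R'' (RAdd (RReg ''R'') xx)))))))))"

text \<open>
  After the loop over \<open>j\<close>, the terms that involve diagonal entries only are added, once per row.
\<close>

definition row_step :: com where
  "row_step =
    (let bi = RReg ''bi''; R = RReg ''R''; bb = RMul bi bi in
     Seq (SetRReg ''bi'' (centred (RConst 0) (IReg ''i'') (IReg ''i'')))
    (Seq (SetRReg ''R'' (RConst 0))
    (Seq (for_loop ''j'' (IReg ''n'') entry_step)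
    (Seq (SetRReg ''T'' (RAdd (RReg ''T'') (RSub (RMul (RConst 2) (RMul bi bb)) (RMul (RConst 3) (RMul bi R)))))
         (SetRReg ''Q'' (RAdd (RReg ''Q'') (RSub (RSub (RMul (RConst 8) (RMul bb R))
            (RMul (RConst 6) (RMul bb bb))) (RMul (RConst 2) (RMul R R)))))))))"

definition accumulate_statistics :: com where
  "accumulate_statistics = Seq (SetRReg ''T'' (RConst 0)) (Seq (SetRReg ''Q'' (RConst 0))
     (for_loop ''i'' (IReg ''n'')
       (If (ILess (IConst 0) (degree_of (IReg ''i''))) row_step (SetRReg ''R'' (RConst 0)))))"

definition cycle_program :: com where
  "cycle_program = Seq load_matrix (Seq compute_degrees (Seq compute_degree_image accumulate_statistics))"

section \<open>Correctness and running time\<close>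

locale network =
  fixes n :: nat and A :: "real mat" and L :: "nat list list"
  assumes adj: "adjacency_mat n A" and edge: "has_edge A" and lists: "adjacency_lists n A L"
begin

abbreviation "a i j \<equiv> A $$ (i, j)"
abbreviation "deg i \<equiv> length (L ! i)"
abbreviation "d i \<equiv> real (deg i)"

text \<open>
  The volume is kept as a natural number, since it also bounds running times.
\<close>

definition "vol = (\<Sum>i<n. deg i)"
abbreviation "V \<equiv> real vol"

definition "b i j = a i j - d i * d j / V"
definition "p i j = (\<Sum>k<n. b i k * b k j)"
definition "w i = (\<Sum>j<n. a i j * d j)"
definition "S = (\<Sum>i<n. d i ^ 2)"

lemma dim_A: "dim_row A = n" "dim_col A = n" and A_carrier: "A \<in> carrier_mat n n"
  using adj by (auto simp: adjacency_mat_def)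

lemma a_sym: "a i j = a j i" if "i < n" "j < n"
  using adj that index_transpose_mat(1)[of j A i] by (auto simp: adjacency_mat_def)

lemma a_values: "i < n \<Longrightarrow> j < n \<Longrightarrow> a i j = 0 \<or> a i j = 1" and a_diag: "i < n \<Longrightarrow> a i i = 0"
  using adj by (auto simp: adjacency_mat_def)

lemma set_nbr: "i < n \<Longrightarrow> set (L ! i) = {j. j < n \<and> a i j = 1}"
  and distinct_nbr: "i < n \<Longrightarrow> distinct (L ! i)" and length_L: "length L = n"
  using lists by (auto simp: adjacency_lists_def)

lemma nbr_less: "i < n \<Longrightarrow> m < deg i \<Longrightarrow> L ! i ! m < n"
  using set_nbr[of i] nth_mem[of m "L ! i"] by auto

lemma sum_neighbours:
  assumes "i < n"
  shows "(\<Sum>m<deg i. f (L ! i ! m)) = (\<Sum>j<n. a i j * f j)"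
proof -
  have "(\<Sum>m<deg i. f (L ! i ! m)) = sum_list (map f (L ! i))"
    by (simp add: sum_list_sum_nth atLeast0LessThan)
  also have "\<dots> = sum f {j. j < n \<and> a i j = 1}"
    using assms by (simp add: sum_list_distinct_conv_sum_set distinct_nbr set_nbr)
  also have "\<dots> = (\<Sum>j<n. a i j * f j)"
    using assms by (intro sum.mono_neutral_cong_left) (auto dest: a_values)
  finally show ?thesis .
qed

lemma d_eq: "i < n \<Longrightarrow> d i = (\<Sum>j<n. a i j)"
  using sum_neighbours[of i "\<lambda>_. 1"] by simp

lemma vol_pos: "vol > 0"
proof -
  obtain i j where ij: "i < n" "j < n" "a i j = 1"
    using edge by (auto simp: has_edge_def dim_A)
  then have "j \<in> set (L ! i)" by (simp add: set_nbr)
  then have "0 < deg i" by (rule length_pos_if_in_set)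
  also have "deg i \<le> vol"
    unfolding vol_def using ij(1) by (intro member_le_sum) simp_all
  finally show ?thesis .
qed

lemma n_pos: "n > 0"
  using vol_pos unfolding vol_def by (cases n) auto

lemma isolated: "i < n \<Longrightarrow> j < n \<Longrightarrow> deg i = 0 \<Longrightarrow> a i j = 0"
  using set_nbr[of i] a_values[of i j] by auto

lemma b_sym: "i < n \<Longrightarrow> j < n \<Longrightarrow> b i j = b j i"
  by (simp add: b_def a_sym mult.commute)

text \<open>
  The rank-one structure behind the running time: only the sum over the neighbours of \<open>i\<close> depends on
  the pair of nodes in a way that is not captured by the precomputed \<open>w\<close>, \<open>S\<close> and \<open>V\<close>.
\<close>

lemma p_eq:
  assumes "i < n" "j < n"
  shows "p i j = (\<Sum>m<deg i. b (L ! i ! m) j) - d i * (w j - S * d j / V) / V"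
proof -
  have "(\<Sum>k<n. d k * b k j) = (\<Sum>k<n. a j k * d k) - (\<Sum>k<n. d k ^ 2 * d j / V)"
    unfolding sum_subtractf[symmetric]
    using assms by (intro sum.cong refl) (simp add: b_def a_sym algebra_simps power2_eq_square)
  then have S: "(\<Sum>k<n. d k * b k j) = w j - S * d j / V"
    by (simp add: w_def S_def sum_distrib_right sum_divide_distrib)
  have "p i j = (\<Sum>k<n. a i k * b k j) - (\<Sum>k<n. d i / V * (d k * b k j))"
    unfolding p_def sum_subtractf[symmetric]
    by (intro sum.cong refl) (simp add: b_def[of i] algebra_simps)
  also have "(\<Sum>k<n. d i / V * (d k * b k j)) = d i * (w j - S * d j / V) / V"
    by (simp only: sum_distrib_left[symmetric] S) simp
  also have "(\<Sum>k<n. a i k * b k j) = (\<Sum>m<deg i. b (L ! i ! m) j)"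
    using sum_neighbours[OF assms(1), of "\<lambda>k. b k j"] by simp
  finally show ?thesis .
qed

definition input :: "state \<Rightarrow> bool" where
  "input s \<longleftrightarrow> ireg s ''n'' = n \<and> (\<forall>i<n. iarr s ''deg'' i 0 = deg i) \<and>
     (\<forall>i<n. \<forall>m<deg i. iarr s ''nbr'' i m = L ! i ! m)"

definition has_matrix :: "state \<Rightarrow> bool" where
  "has_matrix s \<longleftrightarrow> input s \<and> (\<forall>i<n. \<forall>j<n. rarr s ''A'' i j = a i j)"

definition has_degrees :: "state \<Rightarrow> bool" where
  "has_degrees s \<longleftrightarrow> has_matrix s \<and> (\<forall>i<n. rarr s ''D'' i 0 = d i) \<and> rreg s ''V'' = V \<and> rreg s ''S'' = S"

definition has_degree_image :: "state \<Rightarrow> bool" where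
  "has_degree_image s \<longleftrightarrow> has_degrees s \<and> (\<forall>i<n. rarr s ''W'' i 0 = w i)"

lemma input_input_state: "input (input_state L)"
  by (simp add: input_def input_state_def length_L)

lemma runs_load_matrix:
  assumes "input s" "\<And>i j. rarr s ''A'' i j = 0"
  shows "runs load_matrix s (15 * vol + 14 * n + 5) has_matrix"
proof -
  \<comment> \<open>\<open>I\<close> after \<open>k\<close> complete rows, \<open>J\<close> after \<open>m\<close> further entries of row \<open>k\<close>.\<close>
  define I where "I k s \<longleftrightarrow> input s \<and> ireg s ''i'' = k \<and>
      (\<forall>i<n. \<forall>j<n. rarr s ''A'' i j = (if i < k then a i j else 0))" for k s
  define J where "J k m s \<longleftrightarrow> input s \<and> ireg s ''i'' = k \<and> ireg s ''m'' = m \<and>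
      (\<forall>i<n. \<forall>j<n. rarr s ''A'' i j =
        (if i < k \<or> i = k \<and> j \<in> set (take m (L ! k)) then a i j else 0))" for k m s
  have "runs load_matrix s ((\<Sum>k<n. (\<Sum>m<deg k. 6) + deg k * (6 + icost (degree_of (IReg ''i'')))
      + (4 + icost (degree_of (IReg ''i'')))) + n * (6 + icost (IReg ''n'')) + (4 + icost (IReg ''n''))) has_matrix"
    unfolding load_matrix_def
  proof (rule runs_for_loop[of I])
    fix k s assume k: "k < n" "I k s"
    show "runs (for_loop ''m'' (degree_of (IReg ''i'')) (SetRArr ''A'' (IReg ''i'') neighbour (RConst 1))) s
        ((\<Sum>m<deg k. 6) + deg k * (6 + icost (degree_of (IReg ''i''))) + (4 + icost (degree_of (IReg ''i''))))
        (\<lambda>s'. I (Suc k) (set_ireg ''i'' (Suc (ireg s' ''i'')) s'))"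
    proof (rule runs_for_loop[of "J k"])
      show "ireg s ''m'' = m \<and> ival (degree_of (IReg ''i'')) s = deg k" if "J k m s" for m s
        using that k(1) by (simp add: J_def input_def degree_of_def)
      show "J k 0 (set_ireg ''m'' 0 s)"
        using k by (simp add: I_def J_def input_def)
      fix m s assume m: "m < deg k" "J k m s"
      have v: "ival neighbour s = L ! k ! m"
        using m k(1) by (simp add: J_def input_def neighbour_def)
      have one: "a k (L ! k ! m) = 1"
        using set_nbr[OF k(1)] nth_mem[OF m(1)] by auto
      have take: "set (take (Suc m) (L ! k)) = insert (L ! k ! m) (set (take m (L ! k)))"
        using m(1) by (simp add: take_Suc_conv_app_nth)
      show "runs (SetRArr ''A'' (IReg ''i'') neighbour (RConst 1)) s 6
          (\<lambda>s'. J k (Suc m) (set_ireg ''m'' (Suc (ireg s' ''m'')) s'))"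
      proof (rule runs_weaken[OF runs_SetRArr])
        show "J k (Suc m) (set_ireg ''m'' (Suc (ireg (s\<lparr>rarr := upd2 (rarr s) ''A'' (ival (IReg ''i'') s)
            (ival neighbour s) (rval (RConst 1) s)\<rparr>) ''m'')) (s\<lparr>rarr := upd2 (rarr s) ''A''
            (ival (IReg ''i'') s) (ival neighbour s) (rval (RConst 1) s)\<rparr>))"
          unfolding v using m(2) by (simp add: J_def input_def upd2_def take one)
      qed (simp add: neighbour_def)
    next
      fix s assume J: "J k (deg k) s"
      have "a k j = 0" if "j < n" "j \<notin> set (L ! k)" for j
        using that set_nbr[OF k(1)] a_values[OF k(1), of j] by auto
      then show "I (Suc k) (set_ireg ''i'' (Suc (ireg s ''i'')) s)"
        using J by (simp add: I_def J_def input_def less_Suc_eq)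
    qed
  qed (use assms in \<open>auto simp: I_def input_def has_matrix_def\<close>)
  then show ?thesis
    by (rule runs_weaken) (simp add: degree_of_def vol_def sum.distrib sum_distrib_left algebra_simps)
qed

lemma runs_compute_degrees:
  assumes "has_matrix s"
  shows "runs compute_degrees s (13 * vol + 40 * n + 9) has_degrees"
proof -
  define I where "I k s \<longleftrightarrow> has_matrix s \<and> ireg s ''i'' = k \<and> (\<forall>i<k. rarr s ''D'' i 0 = d i) \<and>
      rreg s ''V'' = (\<Sum>i<k. d i) \<and> rreg s ''S'' = (\<Sum>i<k. d i ^ 2)" for k s
  have "runs compute_degrees s (2 + (2 + ((\<Sum>k<n. 13 * deg k + 30) + n * (6 + icost (IReg ''n''))
      + (4 + icost (IReg ''n''))))) has_degrees"
    unfolding compute_degrees_def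
    apply (intro runs_Seq)
    apply (rule runs_weaken[OF runs_SetRReg])
    apply (rule runs_Seq)
    apply (rule runs_weaken[OF runs_SetRReg])
    apply (rule runs_for_loop[of I])
    subgoal by (simp add: I_def has_matrix_def input_def)
    subgoal using assms by (simp add: I_def has_matrix_def input_def)
    subgoal for k s
      apply (rule runs_weaken)
       apply (rule runs_Seq)
       apply (rule runs_neighbour_sum[where D = "deg k" and f = "\<lambda>_. 1"])
      subgoal by (simp add: I_def has_matrix_def input_def)
      subgoal by simp
       apply (rule runs_Seq runs_SetRArr runs_SetRReg)+
      subgoal by (simp add: I_def has_matrix_def input_def upd2_def less_Suc_eq power2_eq_square)
      subgoal by simp
      done
    subgoal by (simp add: I_def has_degrees_def vol_def S_def)
    subgoal by simp
    subgoal by simp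
    done
  then show ?thesis
    by (rule runs_weaken) (simp add: vol_def sum.distrib sum_distrib_left algebra_simps)
qed

lemma runs_compute_degree_image:
  assumes "has_degrees s"
  shows "runs compute_degree_image s (17 * vol + 40 * n + 5) has_degree_image"
proof -
  define I where "I k s \<longleftrightarrow> has_degrees s \<and> ireg s ''i'' = k \<and> (\<forall>i<k. rarr s ''W'' i 0 = w i)" for k s
  have "runs compute_degree_image s ((\<Sum>k<n. 17 * deg k + 20) + n * (6 + icost (IReg ''n''))
      + (4 + icost (IReg ''n''))) has_degree_image"
    unfolding compute_degree_image_def
    apply (rule runs_for_loop[of I])
    subgoal by (simp add: I_def has_degrees_def has_matrix_def input_def)
    subgoal using assms by (simp add: I_def has_degrees_def has_matrix_def input_def)
    subgoal for k s
      apply (rule runs_weaken)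
       apply (rule runs_Seq)
       apply (rule runs_neighbour_sum[where D = "deg k" and f = "\<lambda>m. d (L ! k ! m)"])
      subgoal by (simp add: I_def has_degrees_def has_matrix_def input_def)
      subgoal by (simp add: I_def has_degrees_def has_matrix_def input_def neighbour_def nbr_less)
       apply (rule runs_SetRArr)
      subgoal
        by (simp add: I_def has_degrees_def has_matrix_def input_def upd2_def less_Suc_eq w_def
            sum_neighbours[where f = d])
      subgoal by (simp add: neighbour_def)
      done
    subgoal by (simp add: I_def has_degree_image_def)
    done
  then show ?thesis
    by (rule runs_weaken) (simp add: vol_def sum.distrib sum_distrib_left algebra_simps)
qed

text \<open>
  The closed forms of the statistics, split into contributions of entries and of rows as the program
  accumulates them.
\<close>

definition "T_entry i j = p i j * b i j"
definition "Q_entry i j = p i j ^ 2 - 4 * b i i * p i j * b i j + 2 * b i i * b i j ^ 2 * b j j + b i j ^ 4"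
definition "T_row i = (\<Sum>j<n. T_entry i j) + 2 * b i i ^ 3 - 3 * b i i * p i i"
definition "Q_row i = (\<Sum>j<n. Q_entry i j) + 8 * b i i ^ 2 * p i i - 6 * b i i ^ 4 - 2 * p i i ^ 2"

lemma p_diag: "i < n \<Longrightarrow> p i i = (\<Sum>j<n. b i j ^ 2)"
  unfolding p_def by (intro sum.cong refl) (simp add: b_sym power2_eq_square)

text \<open>
  This justifies that the program skips isolated nodes.
\<close>

lemma isolated_row: "i < n \<Longrightarrow> deg i = 0 \<Longrightarrow> T_row i = 0 \<and> Q_row i = 0"
  by (simp add: T_row_def Q_row_def T_entry_def Q_entry_def p_def b_def isolated)

lemma rval_centred:
  assumes "has_degrees s" "ival v s < n" "ival u s < n" "rval r s = a (ival v s) (ival u s)"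
  shows "rval (centred r v u) s = b (ival v s) (ival u s)"
  using assms by (simp add: centred_def has_degrees_def b_def)

text \<open>
  These two rules speak of an arbitrary register file \<open>f\<close> instead of a single assignment, so that they
  still match after the simplifier has merged several updates.
\<close>

lemma has_degree_image_update_ireg [simp]:
  "f ''n'' = ireg s ''n'' \<Longrightarrow> has_degree_image (s\<lparr>ireg := f\<rparr>) \<longleftrightarrow> has_degree_image s"
  by (simp add: has_degree_image_def has_degrees_def has_matrix_def input_def)

lemma has_degree_image_update_rreg [simp]:
  "f ''V'' = rreg s ''V'' \<Longrightarrow> f ''S'' = rreg s ''S'' \<Longrightarrow>
    has_degree_image (s\<lparr>rreg := f\<rparr>) \<longleftrightarrow> has_degree_image s"
  by (simp add: has_degree_image_def has_degrees_def has_matrix_def input_def)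

lemma has_degree_imageD:
  assumes "has_degree_image s"
  shows "has_degrees s" and "ireg s ''n'' = n" and "i < n \<Longrightarrow> iarr s ''deg'' i 0 = deg i"
    and "i < n \<Longrightarrow> m < deg i \<Longrightarrow> iarr s ''nbr'' i m = L ! i ! m"
    and "i < n \<Longrightarrow> j < n \<Longrightarrow> rarr s ''A'' i j = a i j" and "i < n \<Longrightarrow> rarr s ''D'' i 0 = d i"
    and "i < n \<Longrightarrow> rarr s ''W'' i 0 = w i" and "rreg s ''V'' = V" and "rreg s ''S'' = S"
  using assms by (simp_all add: has_degree_image_def has_degrees_def has_matrix_def input_def)

lemma runs_entry_step:
  assumes image: "has_degree_image s" and i: "ireg s ''i'' = i" "i < n" and j: "ireg s ''j'' = j" "j < n"
    and bi: "rreg s ''bi'' = b i i"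
    and Q: "\<And>s'. has_degree_image s' \<Longrightarrow> ireg s' ''i'' = i \<Longrightarrow> ireg s' ''j'' = j \<Longrightarrow>
      rreg s' ''bi'' = b i i \<Longrightarrow> rreg s' ''T'' = rreg s ''T'' + T_entry i j \<Longrightarrow>
      rreg s' ''Q'' = rreg s ''Q'' + Q_entry i j \<Longrightarrow> rreg s' ''R'' = rreg s ''R'' + b i j ^ 2 \<Longrightarrow> Q s'"
  shows "runs entry_step s (40 * deg i + 120) Q"
proof -
  have sq: "p i j * p i j - 4 * (b i i * (p i j * b i j))
      + b i j ^ 2 * (b i j ^ 2 + 2 * (b i i * b j j)) = Q_entry i j"
    by (simp add: Q_entry_def algebra_simps power2_eq_square power4_eq_xxxx)
  note D = has_degree_imageD(2-)[OF image]
  show ?thesis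
    unfolding entry_step_def Let_def
    apply (rule runs_weaken)
     apply (rule runs_Seq)
     apply (rule runs_SetRReg)
     apply (rule runs_Seq)
     apply (rule runs_neighbour_sum[where D = "deg i" and f = "\<lambda>m. b (L ! i ! m) j"])
    subgoal using i D by simp
    subgoal using i j D image by (simp add: rval_centred neighbour_def nbr_less has_degree_imageD(1))
     apply (rule runs_Seq)
     apply (rule runs_SetRReg_value[where v = "p i j"])
    subgoal using i j D image by (simp add: rval_centred has_degree_imageD(1) p_eq)
     apply (rule runs_Seq)
     apply (rule runs_SetRReg_value[where v = "b j j"])
    subgoal using i j D image by (simp add: rval_centred has_degree_imageD(1) a_diag)
     apply (rule runs_Seq)
     apply (rule runs_SetRReg_value[where v = "b i j ^ 2"])
    subgoal using i j D image by (simp add: rval_centred has_degree_imageD(1) power2_eq_square)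
     apply (rule runs_Seq)
     apply (rule runs_SetRReg_value[where v = "rreg s ''T'' + T_entry i j"])
    subgoal using i j D image by (simp add: rval_centred has_degree_imageD(1) T_entry_def)
     apply (rule runs_Seq)
     apply (rule runs_SetRReg_value[where v = "rreg s ''Q'' + Q_entry i j"])
    subgoal using i j D image bi by (simp add: rval_centred has_degree_imageD(1) sq)
     apply (rule runs_SetRReg_value[where v = "rreg s ''R'' + b i j ^ 2"])
    subgoal by simp
    subgoal using i j image bi by (intro Q) simp_all
    subgoal by (simp add: centred_def neighbour_def)
    done
qed

lemma runs_row_step:
  assumes image: "has_degree_image s" and i: "ireg s ''i'' = i" "i < n"
    and Q: "\<And>s'. has_degree_image s' \<Longrightarrow> ireg s' ''i'' = i \<Longrightarrow>
      rreg s' ''T'' = rreg s ''T'' + T_row i \<Longrightarrow> rreg s' ''Q'' = rreg s ''Q'' + Q_row i \<Longrightarrow> Q s'"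
  shows "runs row_step s (n * (40 * deg i + 127) + 80) Q"
proof -
  define I where "I k s' \<longleftrightarrow> has_degree_image s' \<and> ireg s' ''i'' = i \<and> ireg s' ''j'' = k \<and>
      rreg s' ''bi'' = b i i \<and> rreg s' ''T'' = rreg s ''T'' + (\<Sum>j<k. T_entry i j) \<and>
      rreg s' ''Q'' = rreg s ''Q'' + (\<Sum>j<k. Q_entry i j) \<and> rreg s' ''R'' = (\<Sum>j<k. b i j ^ 2)" for k s'
  show ?thesis
    unfolding row_step_def Let_def
    apply (rule runs_weaken)
     apply (rule runs_Seq)
     apply (rule runs_SetRReg)
     apply (rule runs_Seq)
     apply (rule runs_SetRReg)
     apply (rule runs_Seq)
     apply (rule runs_for_loop[where I = I and N = n and t = "\<lambda>_. 40 * deg i + 120"])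
    subgoal by (simp add: I_def has_degree_imageD)
    subgoal using image i by (simp add: I_def rval_centred has_degree_imageD(1) a_diag)
    subgoal for k s'
      using i(2) by (intro runs_entry_step[where i = i and j = k]) (simp_all add: I_def)
     apply (rule runs_Seq runs_SetRReg)+
    subgoal
      apply (rule Q)
      using i
      by (simp_all add: I_def p_diag[symmetric] T_row_def Q_row_def)
         (simp_all add: power2_eq_square power3_eq_cube power4_eq_xxxx)
    subgoal by (simp add: centred_def algebra_simps)
    done
qed

text \<open>
  For a node of positive degree, the part of the cost of a row that is independent of the degree is
  at most a constant times \<open>n * deg k\<close> as well. This is where skipping the isolated nodes turns
  \<open>n\<^sup>2\<close> into \<open>n * vol\<close>.
\<close>

lemma runs_accumulate_statistics:
  assumes "has_degree_image s"
  shows "runs accumulate_statistics s (260 * (n * vol) + 20 * n + 9)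
    (\<lambda>s'. rreg s' ''T'' = (\<Sum>i<n. T_row i) \<and> rreg s' ''Q'' = (\<Sum>i<n. Q_row i))"
proof -
  define I where "I k s \<longleftrightarrow> has_degree_image s \<and> ireg s ''i'' = k \<and>
      rreg s ''T'' = (\<Sum>i<k. T_row i) \<and> rreg s ''Q'' = (\<Sum>i<k. Q_row i)" for k s
  have "runs accumulate_statistics s (2 + (2 + ((\<Sum>k<n. 260 * (n * deg k) + 10) + n * (6 + icost (IReg ''n''))
      + (4 + icost (IReg ''n'')))))
      (\<lambda>s'. rreg s' ''T'' = (\<Sum>i<n. T_row i) \<and> rreg s' ''Q'' = (\<Sum>i<n. Q_row i))"
    unfolding accumulate_statistics_def
    apply (rule runs_Seq)
    apply (rule runs_weaken[OF runs_SetRReg])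
     apply (rule runs_Seq)
     apply (rule runs_weaken[OF runs_SetRReg])
      apply (rule runs_for_loop[of I])
    subgoal by (simp add: I_def has_degree_imageD)
    subgoal using assms by (simp add: I_def)
    subgoal premises prems for k s
    proof -
      have "runs (If (ILess (IConst 0) (degree_of (IReg ''i''))) row_step (SetRReg ''R'' (RConst 0))) s
          (tcost (ILess (IConst 0) (degree_of (IReg ''i''))) + (260 * (n * deg k) + 3))
          (\<lambda>s'. I (Suc k) (set_ireg ''i'' (Suc (ireg s' ''i'')) s'))"
      proof (rule runs_If)
        assume "tval (ILess (IConst 0) (degree_of (IReg ''i''))) s"
        then have deg: "0 < deg k"
          using prems by (simp add: I_def degree_of_def has_degree_imageD)
        then have "n \<le> n * deg k" and "1 \<le> n * deg k"
          using prems(1) by (cases "deg k", simp, simp)+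
        moreover have "n * (40 * deg k + 127) + 80 = 40 * (n * deg k) + 127 * n + 80"
          by (simp add: algebra_simps)
        ultimately have cost: "n * (40 * deg k + 127) + 80 \<le> 260 * (n * deg k) + 3"
          by linarith
        show "runs row_step s (260 * (n * deg k) + 3) (\<lambda>s'. I (Suc k) (set_ireg ''i'' (Suc (ireg s' ''i'')) s'))"
          using prems by (intro runs_weaken[OF runs_row_step cost]) (auto simp: I_def)
      next
        assume "\<not> tval (ILess (IConst 0) (degree_of (IReg ''i''))) s"
        then have "deg k = 0"
          using prems by (simp add: I_def degree_of_def has_degree_imageD)
        then show "runs (SetRReg ''R'' (RConst 0)) s (260 * (n * deg k) + 3)
            (\<lambda>s'. I (Suc k) (set_ireg ''i'' (Suc (ireg s' ''i'')) s'))"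
          using prems isolated_row[of k] by (intro runs_weaken[OF runs_SetRReg]) (simp_all add: I_def)
      qed
      then show ?thesis by (rule runs_weaken) (simp add: degree_of_def)
    qed
    subgoal by (simp add: I_def)
    subgoal by simp
    subgoal by simp
    done
  then show ?thesis
    by (rule runs_weaken) (simp add: vol_def sum.distrib sum_distrib_left sum_distrib_right algebra_simps)
qed

lemma runs_cycle_program:
  "runs cycle_program (input_state L) (450 * (n * vol))
    (\<lambda>s. rreg s ''T'' = (\<Sum>i<n. T_row i) \<and> rreg s ''Q'' = (\<Sum>i<n. Q_row i))"
proof -
  have "runs cycle_program (input_state L) ((15 * vol + 14 * n + 5) + ((13 * vol + 40 * n + 9)
      + ((17 * vol + 40 * n + 5) + (260 * (n * vol) + 20 * n + 9))))
    (\<lambda>s. rreg s ''T'' = (\<Sum>i<n. T_row i) \<and> rreg s ''Q'' = (\<Sum>i<n. Q_row i))"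
    unfolding cycle_program_def
    by (intro runs_Seq runs_mono[OF runs_load_matrix] runs_mono[OF runs_compute_degrees]
        runs_mono[OF runs_compute_degree_image] runs_accumulate_statistics input_input_state)
      (simp_all add: input_state_def)
  moreover have "n \<le> n * vol" "vol \<le> n * vol" "1 \<le> n * vol"
    using mult_le_mono2[of 1 vol n] mult_le_mono1[of 1 n vol] mult_le_mono[of 1 n 1 vol] vol_pos n_pos
    by simp_all
  ultimately show ?thesis
    by (elim runs_weaken) linarith
qed

lemma degree_vec: "k < n \<Longrightarrow> (A *\<^sub>v ones_vec n) $ k = d k"
  using A_carrier by (simp add: ones_vec_def scalar_prod_def atLeast0LessThan d_eq)

lemma total_degree_eq: "total_degree A = V"
  using ones_quadratic_form[OF A_carrier] by (simp add: total_degree_def dim_A vol_def d_eq)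

lemma A_tilde_index:
  assumes "i < n" "j < n"
  shows "A_tilde A $$ (i, j) = b i j"
proof -
  \<comment> \<open>The square root of \<open>V\<close> cancels.\<close>
  have "V powr (- 1 / 2) * V powr (- 1 / 2) = 1 / V"
    using vol_pos by (simp add: powr_add[symmetric] powr_minus_divide)
  then have "V powr (- 1 / 2) * d i * (V powr (- 1 / 2) * d j) = d i * d j / V"
    by (metis (no_types, opaque_lifting) mult.assoc mult.left_commute times_divide_eq_left mult_1)
  then show ?thesis
    using assms by (simp add: A_tilde_def outer_prod_def eta_hat_def dim_A total_degree_eq degree_vec b_def
        del: index_mult_mat_vec)
qed

lemma statistics_eq_row_sums:
  "T_stat A = (\<Sum>i<n. T_row i)" "Q_stat A = (\<Sum>i<n. Q_row i)"
proof -
  note sums = T_stat_eq_sums[OF adj] Q_stat_eq_sums[OF adj]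
  show "T_stat A = (\<Sum>i<n. T_row i)"
    unfolding sums
    by (simp add: A_tilde_index T_row_def T_entry_def p_def sum.distrib sum_subtractf sum_distrib_left mult.assoc)
  show "Q_stat A = (\<Sum>i<n. Q_row i)"
    unfolding sums
    by (simp add: A_tilde_index Q_row_def Q_entry_def p_def[symmetric] sum.distrib sum_subtractf sum_distrib_left mult.assoc)
qed

end

theorem theorem1p1:
  shows
    "(\<forall>n A. adjacency_mat n A \<and> has_edge A \<longrightarrow>
        (let B = A_tilde A in
           T_stat A =
             trace_mat (B ^\<^sub>m 3) - 3 * trace_mat (B \<circ>\<^sub>H B ^\<^sub>m 2) + 2 * trace_mat (B \<circ>\<^sub>H B \<circ>\<^sub>H B) \<and>
           Q_stat A =
             trace_mat (B ^\<^sub>m 4) - 4 * trace_mat (B \<circ>\<^sub>H B ^\<^sub>m 3) + 8 * trace_mat (B \<circ>\<^sub>H B \<circ>\<^sub>H B ^\<^sub>m 2)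
             - 6 * trace_mat (B \<circ>\<^sub>H B \<circ>\<^sub>H B \<circ>\<^sub>H B) - 2 * trace_mat (B ^\<^sub>m 2 \<circ>\<^sub>H B ^\<^sub>m 2)
             + 2 * (ones_vec n \<bullet> ((diag_part B * (B \<circ>\<^sub>H B) * diag_part B) *\<^sub>v ones_vec n))
             + ones_vec n \<bullet> ((B \<circ>\<^sub>H B \<circ>\<^sub>H B \<circ>\<^sub>H B) *\<^sub>v ones_vec n)))
     \<and>
     (\<exists>P C. \<forall>n A L. adjacency_mat n A \<and> has_edge A \<and> adjacency_lists n A L \<longrightarrow>
        (\<exists>t s. exec P (input_state L) t s \<and>
               rreg s ''T'' = T_stat A \<and> rreg s ''Q'' = Q_stat A \<and>
               real t \<le> C * ((real n)\<^sup>2 * avg_degree A)))"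
proof (rule conjI)
  show "\<forall>n A. adjacency_mat n A \<and> has_edge A \<longrightarrow>
        (let B = A_tilde A in
           T_stat A =
             trace_mat (B ^\<^sub>m 3) - 3 * trace_mat (B \<circ>\<^sub>H B ^\<^sub>m 2) + 2 * trace_mat (B \<circ>\<^sub>H B \<circ>\<^sub>H B) \<and>
           Q_stat A =
             trace_mat (B ^\<^sub>m 4) - 4 * trace_mat (B \<circ>\<^sub>H B ^\<^sub>m 3) + 8 * trace_mat (B \<circ>\<^sub>H B \<circ>\<^sub>H B ^\<^sub>m 2)
             - 6 * trace_mat (B \<circ>\<^sub>H B \<circ>\<^sub>H B \<circ>\<^sub>H B) - 2 * trace_mat (B ^\<^sub>m 2 \<circ>\<^sub>H B ^\<^sub>m 2)
             + 2 * (ones_vec n \<bullet> ((diag_part B * (B \<circ>\<^sub>H B) * diag_part B) *\<^sub>v ones_vec n))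
             + ones_vec n \<bullet> ((B \<circ>\<^sub>H B \<circ>\<^sub>H B \<circ>\<^sub>H B) *\<^sub>v ones_vec n))"
  proof (intro allI impI, elim conjE)
    fix n A assume adj: "adjacency_mat n A"
    show "let B = A_tilde A in
           T_stat A =
             trace_mat (B ^\<^sub>m 3) - 3 * trace_mat (B \<circ>\<^sub>H B ^\<^sub>m 2) + 2 * trace_mat (B \<circ>\<^sub>H B \<circ>\<^sub>H B) \<and>
           Q_stat A =
             trace_mat (B ^\<^sub>m 4) - 4 * trace_mat (B \<circ>\<^sub>H B ^\<^sub>m 3) + 8 * trace_mat (B \<circ>\<^sub>H B \<circ>\<^sub>H B ^\<^sub>m 2)
             - 6 * trace_mat (B \<circ>\<^sub>H B \<circ>\<^sub>H B \<circ>\<^sub>H B) - 2 * trace_mat (B ^\<^sub>m 2 \<circ>\<^sub>H B ^\<^sub>m 2)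
             + 2 * (ones_vec n \<bullet> ((diag_part B * (B \<circ>\<^sub>H B) * diag_part B) *\<^sub>v ones_vec n))
             + ones_vec n \<bullet> ((B \<circ>\<^sub>H B \<circ>\<^sub>H B \<circ>\<^sub>H B) *\<^sub>v ones_vec n)"
      using T_stat_eq_sums[OF adj] Q_stat_eq_sums[OF adj]
      unfolding Let_def trace_formulas[OF A_tilde_carrier[OF adj] A_tilde_sym[OF adj]] by (rule conjI)
  qed
  show "\<exists>P C. \<forall>n A L. adjacency_mat n A \<and> has_edge A \<and> adjacency_lists n A L \<longrightarrow>
        (\<exists>t s. exec P (input_state L) t s \<and>
               rreg s ''T'' = T_stat A \<and> rreg s ''Q'' = Q_stat A \<and>
               real t \<le> C * ((real n)\<^sup>2 * avg_degree A))"
  proof (rule exI[of _ cycle_program], rule exI[of _ 450], intro allI impI)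
    fix n A L assume "adjacency_mat n A \<and> has_edge A \<and> adjacency_lists n A L"
    then interpret network n A L by unfold_locales auto
    obtain t s where exec: "exec cycle_program (input_state L) t s" and t: "t \<le> 450 * (n * vol)"
      and "rreg s ''T'' = T_stat A" "rreg s ''Q'' = Q_stat A"
      using runs_cycle_program unfolding runs_def statistics_eq_row_sums by blast
    moreover have "real t \<le> 450 * ((real n)\<^sup>2 * avg_degree A)"
    proof -
      have "real t \<le> real (450 * (n * vol))" using t by (simp only: of_nat_le_iff)
      also have "\<dots> = 450 * ((real n)\<^sup>2 * avg_degree A)"
        using n_pos by (simp add: avg_degree_def total_degree_eq dim_A power2_eq_square)
      finally show ?thesis .
    qed
    ultimately show "\<exists>t s. exec cycle_program (input_state L) t s \<and>
               rreg s ''T'' = T_stat A \<and> rreg s ''Q'' = Q_stat A \<and>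
               real t \<le> 450 * ((real n)\<^sup>2 * avg_degree A)" by blast
  qed
qed

end
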